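(* Let $G$ be a connected graph of order $n_1\ge 2$ and let $H$ be a graph of order $n_2$. Then $$pd(G\odot H)\le \frac{1}{n_1}\dim(G\odot H)+pd(G)+1.$$
   Context: All graphs are finite and simple; $d(u,v)$ is the length of a shortest $u$–$v$ path. For a connected graph $F$ and an ordered set $S=\{s_1,\dots,s_k\}$ of vertices, $r(v|S)=(d(v,s_1),\dots,d(v,s_k))$; $S$ is a resolving set if $r(u|S)\neq r(v|S)$ for all distinct vertices $u,v$; the metric dimension $\dim(F)$ is the minimum cardinality of a resolving set. For an ordered partition $\Pi=\{P_1,\dots,P_t\}$ of $V(F)$, $r(v|\Pi)=(d(v,P_1),\dots,d(v,P_t))$ where $d(v,P_i)=\min_{u\in P_i}d(v,u)$; $\Pi$ is a resolving partition if $r(u|\Pi)\ne r(v|\Pi)$ for all distinct vertices $u,v$; the partition dimension $pd(F)$ is the minimum number of sets in a resolving partition. For graphs $G$ of order $n_1$ (vertices $v_1,\dots,v_{n_1}$) and $H$, the corona product $G\odot H$ is obtained from one copy of $G$ and $n_1$ copies $H_1,\dots,H_{n_1}$ of $H$ by joining $v_i$ by an edge to every vertex of $H_i$. *)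

theory Defs
  imports "Graph_Theory.Graph_Theory" "HOL-Library.Disjoint_Sets"
begin

text \<open>
  Finite simple graphs are the symmetric digraphs given by the locale \<^locale>\<open>pair_graph\<close>:
  every edge is represented by its two opposite arcs.
\<close>

definition graph_dist :: "'a pair_pre_digraph \<Rightarrow> 'a \<Rightarrow> 'a \<Rightarrow> ereal" where
  "graph_dist G u v = wf_digraph.\<mu> (with_proj G) (\<lambda>_. 1) u v"

lemma graph_dist_shortest_path:
  assumes "pair_graph G" and "connected (with_proj G)"
    and "u \<in> pverts G" and "v \<in> pverts G"
  shows "\<exists>p. pre_digraph.apath (with_proj G) u p v \<and>
             graph_dist G u v = ereal (real (length p)) \<and>
             (\<forall>q. pre_digraph.apath (with_proj G) u q v \<longrightarrow> length p \<le> length q)"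
proof -
  interpret pair_graph G by (fact assms(1))
  have sc: "strongly_connected (with_proj G)"
    using symmetric_connected_imp_strongly_connected[OF pair_sym_arcs assms(2)] .
  then have r: "u \<rightarrow>\<^sup>*\<^bsub>with_proj G\<^esub> v" using assms(3,4) by (auto simp: strongly_connected_def)
  have cost: "awalk_cost (\<lambda>_. 1) p = real (length p)" for p :: "('a \<times> 'a) awalk"
    by (induct p) auto
  obtain p where p: "apath u p v" "\<mu> (\<lambda>_. 1) u v = awalk_cost (\<lambda>_. 1) p"
    using no_neg_cyc_reach_imp_path[OF r, of "\<lambda>_. 1"] cost by force
  have "length p \<le> length q" if "apath u q v" for q
  proof -
    have "\<mu> (\<lambda>_. 1) u v \<le> awalk_cost (\<lambda>_. 1) q"
      using that by (intro min_cost_le_walk_cost) (rule awalkI_apath)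
    then show ?thesis using p(2) by (simp add: cost)
  qed
  then show ?thesis using p by (auto simp: graph_dist_def cost)
qed

definition metric_rep :: "'a pair_pre_digraph \<Rightarrow> 'a list \<Rightarrow> 'a \<Rightarrow> ereal list" where
  "metric_rep G S v = map (graph_dist G v) S"

definition resolving_set :: "'a pair_pre_digraph \<Rightarrow> 'a list \<Rightarrow> bool" where
  "resolving_set G S \<longleftrightarrow> distinct S \<and> set S \<subseteq> pverts G \<and>
     (\<forall>u\<in>pverts G. \<forall>v\<in>pverts G. u \<noteq> v \<longrightarrow> metric_rep G S u \<noteq> metric_rep G S v)"

definition metric_dim :: "'a pair_pre_digraph \<Rightarrow> nat" where
  "metric_dim G = (LEAST k. \<exists>S. resolving_set G S \<and> length S = k)"

definition set_dist :: "'a pair_pre_digraph \<Rightarrow> 'a \<Rightarrow> 'a set \<Rightarrow> ereal" where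
  "set_dist G v P = Min (graph_dist G v ` P)"

definition partition_rep :: "'a pair_pre_digraph \<Rightarrow> 'a set list \<Rightarrow> 'a \<Rightarrow> ereal list" where
  "partition_rep G Ps v = map (set_dist G v) Ps"

definition resolving_partition :: "'a pair_pre_digraph \<Rightarrow> 'a set list \<Rightarrow> bool" where
  "resolving_partition G Ps \<longleftrightarrow> distinct Ps \<and> partition_on (pverts G) (set Ps) \<and>
     (\<forall>u\<in>pverts G. \<forall>v\<in>pverts G. u \<noteq> v \<longrightarrow> partition_rep G Ps u \<noteq> partition_rep G Ps v)"

definition partition_dim :: "'a pair_pre_digraph \<Rightarrow> nat" where
  "partition_dim G = (LEAST k. \<exists>Ps. resolving_partition G Ps \<and> length Ps = k)"

text \<open>
  \<open>Inl v\<close> is the vertex \<open>v\<close> of \<open>G\<close>, and \<open>Inr (v, x)\<close> is the vertex \<open>x\<close> of the copy of \<open>H\<close>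
  attached to \<open>v\<close>.
\<close>

definition corona :: "'a pair_pre_digraph \<Rightarrow> 'b pair_pre_digraph \<Rightarrow> ('a + 'a \<times> 'b) pair_pre_digraph"
where
  "corona G H =
     \<lparr> pverts = Inl ` pverts G \<union> Inr ` (pverts G \<times> pverts H),
       parcs = {(Inl u, Inl v) | u v. (u, v) \<in> parcs G}
             \<union> {(Inr (v, x), Inr (v, y)) | v x y. v \<in> pverts G \<and> (x, y) \<in> parcs H}
             \<union> {(Inl v, Inr (v, x)) | v x. v \<in> pverts G \<and> x \<in> pverts H}
             \<union> {(Inr (v, x), Inl v) | v x. v \<in> pverts G \<and> x \<in> pverts H} \<rparr>"

lemma pair_graph_corona:
  assumes "pair_graph G" and "pair_graph H"
  shows "pair_graph (corona G H)"
proof -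
  interpret G: pair_graph G by (fact assms(1))
  interpret H: pair_graph H by (fact assms(2))
  have wf: "fst e \<in> pverts (corona G H) \<and> snd e \<in> pverts (corona G H) \<and> fst e \<noteq> snd e"
    if "e \<in> parcs (corona G H)" for e
    using that G.in_arcsD1 G.in_arcsD2 H.in_arcsD1 H.in_arcsD2 G.pair_no_loops H.pair_no_loops
    by (fastforce simp: corona_def)
  have fin: "finite (pverts (corona G H))"
    using G.pair_finite_verts H.pair_finite_verts by (simp add: corona_def)
  have "parcs (corona G H) \<subseteq> pverts (corona G H) \<times> pverts (corona G H)"
    using wf by (auto simp: mem_Times_iff)
  then have fin': "finite (parcs (corona G H))" using fin finite_subset by blast
  have "sym (parcs G)" "sym (parcs H)"
    using G.pair_sym_arcs H.pair_sym_arcs by (auto simp: symmetric_def)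
  then have "symmetric (with_proj (corona G H))"
    unfolding symmetric_def sym_def by (simp add: corona_def) blast
  then show ?thesis using wf fin fin' by unfold_locales auto
qed

lemma connected_corona:
  assumes "pair_graph G" and "pair_graph H" and "connected (with_proj G)"
  shows "connected (with_proj (corona G H))"
proof -
  interpret G: pair_graph G by (fact assms(1))
  interpret C: pair_graph "corona G H" using pair_graph_corona[OF assms(1,2)] .
  have scG: "strongly_connected (with_proj G)"
    using G.symmetric_connected_imp_strongly_connected[OF G.pair_sym_arcs assms(3)] .
  have arc: "a \<rightarrow>\<^sup>*\<^bsub>with_proj (corona G H)\<^esub> b" if "(a, b) \<in> parcs (corona G H)" for a b
    using that by (intro C.reachable_adjI) simp
  have lift: "Inl u \<rightarrow>\<^sup>*\<^bsub>with_proj (corona G H)\<^esub> Inl v" if "u \<rightarrow>\<^sup>*\<^bsub>with_proj G\<^esub> v" for u v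
    using that
  proof (induct rule: G.reachable_induct)
    case base then show ?case by (intro C.reachable_refl) (auto simp: corona_def)
  next
    case (step x y)
    then have "(Inl x, Inl y) \<in> parcs (corona G H)" by (auto simp: corona_def)
    then show ?case using C.reachable_trans[OF step(3) arc] by simp
  qed
  have root: "\<exists>u\<in>pverts G. a \<rightarrow>\<^sup>*\<^bsub>with_proj (corona G H)\<^esub> Inl u \<and> Inl u \<rightarrow>\<^sup>*\<^bsub>with_proj (corona G H)\<^esub> a"
    if a: "a \<in> pverts (corona G H)" for a
  proof (cases a)
    case (Inl v)
    then show ?thesis using that C.reachable_refl by (intro bexI[of _ v]) (auto simp: corona_def)
  next
    case (Inr c)
    then obtain v x where "a = Inr (v, x)" "v \<in> pverts G" "x \<in> pverts H"
      using a by (cases c) (auto simp: corona_def)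
    then show ?thesis by (intro bexI[of _ v] conjI arc) (auto simp: corona_def)
  qed
  have "strongly_connected (with_proj (corona G H))"
    unfolding strongly_connected_def
  proof (intro conjI ballI)
    show "verts (with_proj (corona G H)) \<noteq> {}"
      using scG by (auto simp: strongly_connected_def corona_def)
  next
    fix a b assume "a \<in> verts (with_proj (corona G H))" "b \<in> verts (with_proj (corona G H))"
    then obtain u v where uv: "u \<in> pverts G" "v \<in> pverts G"
        "a \<rightarrow>\<^sup>*\<^bsub>with_proj (corona G H)\<^esub> Inl u" "Inl v \<rightarrow>\<^sup>*\<^bsub>with_proj (corona G H)\<^esub> b"
      using root[of a] root[of b] by auto
    then have "Inl u \<rightarrow>\<^sup>*\<^bsub>with_proj (corona G H)\<^esub> Inl v"
      using scG by (intro lift) (auto simp: strongly_connected_def)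
    then show "a \<rightarrow>\<^sup>*\<^bsub>with_proj (corona G H)\<^esub> b"
      using C.reachable_trans[OF uv(3) C.reachable_trans[OF _ uv(4)]] by simp
  qed
  then have "(a, b) \<in> rtrancl_on (pverts (corona G H)) ((parcs (corona G H))\<^sup>s)"
    if "a \<in> pverts (corona G H)" and "b \<in> pverts (corona G H)" for a b
    using that
    apply -
    apply (rule rtrancl_on_mono[OF _ subset_refl, of "parcs (corona G H)"])
     apply (simp add: symcl_def)
    apply (simp add: strongly_connected_def reachable_def)
    done
  then show ?thesis
    using \<open>strongly_connected (with_proj (corona G H))\<close>
    by (simp add: connected_conv strongly_connected_def)
qed

end

(* Vertices in the same copy of H are told apart only by landmarks in that copy. By averaging, a
   minimum resolving set of the corona meets some copy of H in a set A of at most dim / n1 vertices,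
   and A separates the vertices of H by equality and adjacency alone. Take a minimum resolving
   partition of G, the class of all copies of a for each a in A, and one class for the rest: the
   classes of G separate vertices attached to different vertices of G, and the copies of A separate
   vertices within one copy of H. *)
theory Submission
  imports Defs
begin

section \<open>Distances\<close>

text \<open>Along each arc of a walk from \<open>u\<close> to \<open>v\<close> the potential
  \<open>f\<close> drops by at most 1, and it ends at a value \<le> 0, so it starts no higher than
  the length of the walk. Exact distances in the corona come from using the conjectured formula as
  \<open>f\<close>.\<close>

lemma potential_le_graph_dist:
  fixes f :: "'a \<Rightarrow> ereal"
  assumes "pair_graph G"
    and lip: "\<And>x y. (x, y) \<in> parcs G \<Longrightarrow> f x \<le> f y + 1"
    and "f v \<le> 0"
  shows "f u \<le> graph_dist G u v"
proof -
  interpret pair_graph G by fact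
  have "f u \<le> ereal (awalk_cost (\<lambda>_. 1) p)" if "awalk u p v" for p
    using that
  proof (induct p arbitrary: u)
    case Nil
    then show ?case using assms(3) by (simp add: awalk_Nil_iff zero_ereal_def)
  next
    case (Cons e p)
    then obtain w where e: "e = (u, w)" "(u, w) \<in> parcs G" "awalk w p v"
      by (cases e) (auto simp: awalk_Cons_iff)
    have "f u \<le> f w + 1" using lip e(2) .
    also have "\<dots> \<le> ereal (awalk_cost (\<lambda>_. 1) p) + 1"
      using Cons(1)[OF e(3)] by (rule add_right_mono)
    finally show ?case by (simp add: add.commute one_ereal_def)
  qed
  then show ?thesis
    unfolding graph_dist_def \<mu>_def by (intro INF_greatest) simp
qed

lemma graph_dist_nonneg: "pair_graph G \<Longrightarrow> 0 \<le> graph_dist G u v"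
  using potential_le_graph_dist[of G "\<lambda>_. 0" v u] by simp

lemma graph_dist_ge_1: "pair_graph G \<Longrightarrow> u \<noteq> v \<Longrightarrow> 1 \<le> graph_dist G u v"
  using potential_le_graph_dist[of G "\<lambda>x. if x = v then 0 else 1" v u] by simp

lemma graph_dist_self:
  assumes "pair_graph G" "u \<in> pverts G"
  shows "graph_dist G u u = 0"
proof -
  interpret pair_graph G by fact
  have "graph_dist G u u \<le> ereal (awalk_cost (\<lambda>_. 1) [])"
    unfolding graph_dist_def
    by (rule min_cost_le_walk_cost) (use assms(2) in \<open>simp add: awalk_Nil_iff\<close>)
  then show ?thesis
    using graph_dist_nonneg[OF assms(1), of u u] by (simp add: zero_ereal_def)
qed

lemma graph_dist_arc_le_1:
  assumes "pair_graph G" "(u, v) \<in> parcs G"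
  shows "graph_dist G u v \<le> 1"
proof -
  interpret pair_graph G by fact
  have "v \<in> pverts G" using in_arcsD2 assms(2) by blast
  then have "graph_dist G u v \<le> ereal (awalk_cost (\<lambda>_. 1) [(u, v)])"
    unfolding graph_dist_def
    by (intro min_cost_le_walk_cost) (use assms(2) in \<open>simp add: awalk_simps\<close>)
  then show ?thesis by (simp add: one_ereal_def)
qed

lemma graph_dist_triangle:
  assumes "pair_graph G"
  shows "graph_dist G u w \<le> graph_dist G u v + graph_dist G v w"
proof -
  interpret pair_graph G by fact
  \<comment> \<open>A finite distance forces reachability, and then some path attains the infimum.
    Two such paths can be concatenated.\<close>
  have attained: "\<exists>p. awalk x p y \<and> graph_dist G x y = ereal (awalk_cost (\<lambda>_. 1) p)"
    if "graph_dist G x y \<noteq> \<infinity>" for x y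
  proof -
    have "x \<rightarrow>\<^sup>*\<^bsub>with_proj G\<^esub> y"
      using that shortest_path_inf unfolding graph_dist_def by blast
    then show ?thesis
      unfolding graph_dist_def using min_cost_awalk[of x y "\<lambda>_. 1"] awalkI_apath by fastforce
  qed
  show ?thesis
  proof (cases "graph_dist G u v = \<infinity> \<or> graph_dist G v w = \<infinity>")
    case True
    then show ?thesis by auto
  next
    case False
    then obtain p q where p: "awalk u p v" "graph_dist G u v = ereal (awalk_cost (\<lambda>_. 1) p)"
      and q: "awalk v q w" "graph_dist G v w = ereal (awalk_cost (\<lambda>_. 1) q)"
      using attained by blast
    have "graph_dist G u w \<le> ereal (awalk_cost (\<lambda>_. 1) (p @ q))"
      unfolding graph_dist_def using p(1) q(1) by (intro min_cost_le_walk_cost awalk_appendI)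
    then show ?thesis using p(2) q(2) by simp
  qed
qed

text \<open>Makes the distance to a fixed vertex admissible as a potential in
  \<open>potential_le_graph_dist\<close>.\<close>

lemma graph_dist_arc_lipschitz:
  assumes "pair_graph G" "(x, y) \<in> parcs G"
  shows "graph_dist G x v \<le> graph_dist G y v + 1"
proof -
  have "graph_dist G x v \<le> graph_dist G x y + graph_dist G y v"
    by (rule graph_dist_triangle[OF assms(1)])
  also have "\<dots> \<le> 1 + graph_dist G y v"
    using graph_dist_arc_le_1[OF assms] by (rule add_right_mono)
  finally show ?thesis by (simp add: add.commute)
qed

lemma set_dist_eq_0_iff:
  assumes "pair_graph G" "P \<subseteq> pverts G" "P \<noteq> {}"
  shows "set_dist G v P = 0 \<longleftrightarrow> v \<in> P"
proof -
  interpret pair_graph G by fact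
  have fin: "finite P" using assms(2) pair_finite_verts finite_subset by blast
  show ?thesis
  proof
    assume "set_dist G v P = 0"
    then have "0 \<in> graph_dist G v ` P"
      unfolding set_dist_def using Min_in[of "graph_dist G v ` P"] fin assms(3) by simp
    then show "v \<in> P" using graph_dist_ge_1[OF assms(1), of v] by force
  next
    assume "v \<in> P"
    then show "set_dist G v P = 0"
      unfolding set_dist_def
      using fin graph_dist_nonneg[OF assms(1)] graph_dist_self[OF assms(1), of v] assms(2)
      by (intro Min_eqI) force+
  qed
qed

section \<open>Minimum resolving sets and partitions\<close>

text \<open>Distance 0 to a class means membership, so vertices in different classes are separated
  by the class of either one. Only pairs inside a common class remain to be checked.\<close>

lemma partition_dim_le_card:
  assumes "pair_graph G" "finite \<P>" "partition_on (pverts G) \<P>"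
    and sep: "\<And>C u v. C \<in> \<P> \<Longrightarrow> u \<in> C \<Longrightarrow> v \<in> C \<Longrightarrow> u \<noteq> v \<Longrightarrow>
      \<exists>P\<in>\<P>. set_dist G u P \<noteq> set_dist G v P"
  shows "partition_dim G \<le> card \<P>"
proof -
  obtain Ps where Ps: "set Ps = \<P>" "distinct Ps" using finite_distinct_list[OF assms(2)] by blast
  have "\<exists>P\<in>\<P>. set_dist G u P \<noteq> set_dist G v P"
    if u: "u \<in> pverts G" and uv: "u \<noteq> v" for u v
  proof -
    obtain C where C: "C \<in> \<P>" "u \<in> C" using u assms(3) by (auto simp: partition_on_def)
    have "C \<subseteq> pverts G" "C \<noteq> {}" using C assms(3) by (auto simp: partition_on_def)
    then have "set_dist G u C = 0" "set_dist G v C = 0 \<longleftrightarrow> v \<in> C"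
      using set_dist_eq_0_iff[OF assms(1)] C by auto
    then show ?thesis using sep[OF C _ uv] C(1) by (cases "v \<in> C") force+
  qed
  then have "resolving_partition G Ps"
    using Ps assms(3) unfolding resolving_partition_def partition_rep_def by (auto simp: map_eq_conv)
  then have "partition_dim G \<le> length Ps"
    unfolding partition_dim_def by (intro Least_le) blast
  then show ?thesis using Ps distinct_card by metis
qed

text \<open>The partition into singletons is resolving, so the \<open>LEAST\<close> in
  \<open>partition_dim\<close> is attained.\<close>

lemma obtain_min_resolving_partition:
  assumes "pair_graph G"
  obtains \<Q> where "finite \<Q>" "partition_on (pverts G) \<Q>" "card \<Q> = partition_dim G"
    "\<And>u v. u \<in> pverts G \<Longrightarrow> v \<in> pverts G \<Longrightarrow> u \<noteq> v \<Longrightarrow>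
      \<exists>Q\<in>\<Q>. set_dist G u Q \<noteq> set_dist G v Q"
proof -
  interpret pair_graph G by fact
  obtain xs where xs: "set xs = pverts G" "distinct xs"
    using finite_distinct_list[OF pair_finite_verts] by blast
  have "set_dist G u {u} \<noteq> set_dist G v {u}" if "u \<in> pverts G" "u \<noteq> v" for u v
    using that set_dist_eq_0_iff[OF assms, of "{u}"]
    by (metis empty_not_insert empty_subsetI insert_subset singleton_iff)
  moreover have "partition_on (pverts G) ((\<lambda>x. {x}) ` pverts G)"
    by (auto simp: partition_on_def disjoint_def)
  ultimately have "resolving_partition G (map (\<lambda>x. {x}) xs)"
    unfolding resolving_partition_def partition_rep_def
    using xs by (auto simp: distinct_map inj_on_def)
  then have "\<exists>Ps. resolving_partition G Ps \<and> length Ps = partition_dim G"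
    unfolding partition_dim_def
    using LeastI_ex[of "\<lambda>k. \<exists>Ps. resolving_partition G Ps \<and> length Ps = k"] by blast
  then obtain Ps where "resolving_partition G Ps" "length Ps = partition_dim G" by blast
  then show thesis
    using that[of "set Ps"] unfolding resolving_partition_def partition_rep_def
    by (auto simp: distinct_card)
qed

lemma obtain_min_resolving_set:
  assumes "pair_graph G"
  obtains S where "resolving_set G S" "length S = metric_dim G"
proof -
  interpret pair_graph G by fact
  obtain xs where xs: "set xs = pverts G" "distinct xs"
    using finite_distinct_list[OF pair_finite_verts] by blast
  have "graph_dist G u u \<noteq> graph_dist G v u" if "u \<in> pverts G" "u \<noteq> v" for u v
    using graph_dist_ge_1[OF assms, of v u] graph_dist_self[OF assms that(1)] that by auto
  then have "resolving_set G xs"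
    unfolding resolving_set_def metric_rep_def using xs by (auto simp: map_eq_conv)
  then have "\<exists>S. resolving_set G S \<and> length S = metric_dim G"
    unfolding metric_dim_def
    using LeastI_ex[of "\<lambda>k. \<exists>S. resolving_set G S \<and> length S = k"] by blast
  then show thesis using that by blast
qed

section \<open>Distances in the corona\<close>

text \<open>The distance between two vertices of the same copy of \<open>H\<close> in the corona:
  non-adjacent vertices are joined through their root, so longer distances in \<open>H\<close> are
  cut down to 2.\<close>

definition adj_dist :: "'b pair_pre_digraph \<Rightarrow> 'b \<Rightarrow> 'b \<Rightarrow> ereal" where
  "adj_dist H x y = (if x = y then 0 else if (x, y) \<in> parcs H then 1 else 2)"

lemma adj_dist_bounds: "0 \<le> adj_dist H x y" "adj_dist H x y \<le> 2"
  by (auto simp: adj_dist_def)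

locale corona_graph =
  fixes G :: "'a pair_pre_digraph" and H :: "'b pair_pre_digraph"
  assumes G: "pair_graph G" and H: "pair_graph H"
begin

abbreviation "dC \<equiv> graph_dist (corona G H)"

lemma C: "pair_graph (corona G H)"
  using pair_graph_corona[OF G H] .

text \<open>An upper bound from the potential lemma: it is applied in \<open>G\<close>, with the
  corona distance to \<open>Inl v\<close> as the potential, so no walk has to be transported from
  \<open>G\<close> to the corona.\<close>

lemma dC_Inl_Inl_le:
  assumes "v \<in> pverts G"
  shows "dC (Inl u) (Inl v) \<le> graph_dist G u v"
proof (rule potential_le_graph_dist[OF G])
  fix x y assume "(x, y) \<in> parcs G"
  then show "dC (Inl x) (Inl v) \<le> dC (Inl y) (Inl v) + 1"
    by (intro graph_dist_arc_lipschitz[OF C]) (auto simp: corona_def)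
next
  show "dC (Inl v) (Inl v) \<le> 0"
    using assms graph_dist_self[OF C, of "Inl v"] by (auto simp: corona_def)
qed

lemma dC_root:
  assumes "u \<in> pverts G" "x \<in> pverts H"
  shows "dC (Inr (u, x)) (Inl u) \<le> 1" "dC (Inl u) (Inr (u, x)) \<le> 1"
proof -
  have "(Inr (u, x), Inl u) \<in> parcs (corona G H)" "(Inl u, Inr (u, x)) \<in> parcs (corona G H)"
    using assms by (auto simp: corona_def)
  then show "dC (Inr (u, x)) (Inl u) \<le> 1" "dC (Inl u) (Inr (u, x)) \<le> 1"
    by (auto intro: graph_dist_arc_le_1[OF C])
qed

lemma dC_Inl:
  assumes v: "v \<in> pverts G"
  shows "u \<in> pverts G \<Longrightarrow> dC (Inl u) (Inl v) = graph_dist G u v"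
    and "u \<in> pverts G \<Longrightarrow> x \<in> pverts H \<Longrightarrow> dC (Inr (u, x)) (Inl v) = graph_dist G u v + 1"
proof -
  \<comment> \<open>The two claimed formulas, read as one function of the starting vertex. That
    \<open>f\<close> is a potential on the corona gives both lower bounds at once.\<close>
  define f where "f = case_sum (\<lambda>u. graph_dist G u v) (\<lambda>(u, x :: 'b). graph_dist G u v + 1)"
  have "f a \<le> dC a (Inl v)" for a
  proof (rule potential_le_graph_dist[OF C])
    fix a b assume "(a, b) \<in> parcs (corona G H)"
    moreover have "t \<le> t + 1" "t \<le> t + 1 + 1" for t :: ereal by (cases t; simp add: one_ereal_def)+
    ultimately show "f a \<le> f b + 1"
      using graph_dist_arc_lipschitz[OF G] by (auto simp: f_def corona_def)
  next
    show "f (Inl v) \<le> 0" using graph_dist_self[OF G v] by (simp add: f_def)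
  qed
  from this[of "Inl u"] this[of "Inr (u, x)"]
  have f: "graph_dist G u v \<le> dC (Inl u) (Inl v)" "graph_dist G u v + 1 \<le> dC (Inr (u, x)) (Inl v)"
    by (simp_all add: f_def)
  show eq: "dC (Inl u) (Inl v) = graph_dist G u v" if "u \<in> pverts G"
    using dC_Inl_Inl_le[OF v] f(1) by (rule antisym)
  show "dC (Inr (u, x)) (Inl v) = graph_dist G u v + 1" if u: "u \<in> pverts G" and x: "x \<in> pverts H"
  proof (rule antisym[OF _ f(2)])
    have "dC (Inr (u, x)) (Inl v) \<le> dC (Inr (u, x)) (Inl u) + dC (Inl u) (Inl v)"
      by (rule graph_dist_triangle[OF C])
    also have "\<dots> \<le> 1 + graph_dist G u v"
      using dC_root(1)[OF u x] eq[OF u] by (simp add: add_right_mono)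
    finally show "dC (Inr (u, x)) (Inl v) \<le> graph_dist G u v + 1" by (simp add: add.commute)
  qed
qed

text \<open>A different copy is entered and left only through roots, which costs 1 at each end.
  Within one copy the choice is between an edge of \<open>H\<close> and the detour of length 2
  through the root.\<close>

lemma dC_Inr_Inr:
  assumes u: "u \<in> pverts G" and x: "x \<in> pverts H" and v: "v \<in> pverts G" and a: "a \<in> pverts H"
  shows "dC (Inr (u, x)) (Inr (v, a)) = (if u = v then adj_dist H x a else graph_dist G u v + 2)"
proof -
  define f where "f = case_sum (\<lambda>u. graph_dist G u v + 1)
    (\<lambda>(u, x). if u = v then adj_dist H x a else graph_dist G u v + 2)"
  have "f b \<le> dC b (Inr (v, a))" for b
  proof (rule potential_le_graph_dist[OF C])
    fix b c assume "(b, c) \<in> parcs (corona G H)"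
    moreover have "adj_dist H x a \<le> adj_dist H y a + 1" if "(x, y) \<in> parcs H" for x y
      using that by (auto simp: adj_dist_def)
    \<comment> \<open>For the arcs between the root \<open>v\<close>, where \<open>f\<close> is 1,
      and its own copy, where \<open>f\<close> lies between 0 and 2.\<close>
    moreover have "adj_dist H x a \<le> 1 + 1" "1 \<le> adj_dist H x a + 1" for x
      by (auto simp: adj_dist_def)
    moreover have "t + 2 = t + 1 + 1" "t \<le> t + 1" "t + 1 \<le> t + 2 + 1" for t :: ereal
      by (cases t; simp add: one_ereal_def numeral_eq_ereal)+
    moreover have "graph_dist G v v = 0" using graph_dist_self[OF G v] .
    ultimately show "f b \<le> f c + 1"
      using graph_dist_arc_lipschitz[OF G, of _ _ v] by (auto simp: f_def corona_def add_right_mono)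
  next
    show "f (Inr (v, a)) \<le> 0" by (simp add: f_def adj_dist_def)
  qed
  from this[of "Inr (u, x)"]
  have f: "(if u = v then adj_dist H x a else graph_dist G u v + 2) \<le> dC (Inr (u, x)) (Inr (v, a))"
    by (simp add: f_def)
  \<comment> \<open>The route through the root \<open>v\<close>. For \<open>u = v\<close> its bound
    is 2, which is \<open>adj_dist\<close> for distinct non-adjacent vertices.\<close>
  have "dC (Inr (u, x)) (Inr (v, a)) \<le> dC (Inr (u, x)) (Inl v) + dC (Inl v) (Inr (v, a))"
    by (rule graph_dist_triangle[OF C])
  also have "\<dots> \<le> graph_dist G u v + 1 + 1"
    using dC_root(2)[OF v a] dC_Inl(2)[OF v u x] by (simp add: add_left_mono)
  also have "\<dots> = graph_dist G u v + 2" by (simp add: add.assoc)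
  finally have le: "dC (Inr (u, x)) (Inr (v, a)) \<le> graph_dist G u v + 2" .
  show ?thesis
  proof (rule antisym[OF _ f])
    show "dC (Inr (u, x)) (Inr (v, a)) \<le> (if u = v then adj_dist H x a else graph_dist G u v + 2)"
    proof (cases "u = v")
      case True
      have "dC (Inr (v, x)) (Inr (v, a)) \<le> 1" if "(x, a) \<in> parcs H"
        using that v by (intro graph_dist_arc_le_1[OF C]) (auto simp: corona_def)
      moreover have "dC (Inr (v, a)) (Inr (v, a)) = 0"
        using v a by (intro graph_dist_self[OF C]) (auto simp: corona_def)
      ultimately show ?thesis
        using True le graph_dist_self[OF G v] by (auto simp: adj_dist_def)
    qed (use le in simp)
  qed
qed

lemma set_dist_Inl:
  assumes Q: "Q \<subseteq> pverts G" "Q \<noteq> {}" and u: "u \<in> pverts G"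
  shows "set_dist (corona G H) (Inl u) (Inl ` Q) = set_dist G u Q"
    and "x \<in> pverts H \<Longrightarrow> set_dist (corona G H) (Inr (u, x)) (Inl ` Q) = set_dist G u Q + 1"
proof -
  interpret G: pair_graph G by (rule G)
  have fin: "finite Q" using Q G.pair_finite_verts finite_subset by blast
  have "dC (Inl u) ` Inl ` Q = graph_dist G u ` Q"
    using Q(1) u dC_Inl by (force simp: image_image intro!: image_cong)
  then show "set_dist (corona G H) (Inl u) (Inl ` Q) = set_dist G u Q"
    by (simp add: set_dist_def)
  assume x: "x \<in> pverts H"
  have "dC (Inr (u, x)) ` Inl ` Q = (\<lambda>t. t + 1) ` graph_dist G u ` Q"
    using Q(1) u x dC_Inl by (force simp: image_image intro!: image_cong)
  then show "set_dist (corona G H) (Inr (u, x)) (Inl ` Q) = set_dist G u Q + 1"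
    unfolding set_dist_def
    \<comment> \<open>Every distance from the copy to \<open>Inl ' Q\<close> is shifted by the same
      1, and the minimum commutes with this monotone shift.\<close>
    using mono_Min_commute[of "\<lambda>t. t + 1" "graph_dist G u ` Q"] fin Q(2)
    by (simp add: mono_def add_right_mono)
qed

text \<open>The copies of \<open>a\<close> attached to other roots are at distance at least 2, and
  \<open>adj_dist\<close> never exceeds 2, so the copy of \<open>a\<close> next to \<open>x\<close>
  attains the minimum. Hence all copies of \<open>a\<close> can share one class without losing what
  \<open>a\<close> separates.\<close>

lemma set_dist_copies:
  assumes u: "u \<in> pverts G" and x: "x \<in> pverts H" and a: "a \<in> pverts H"
  shows "set_dist (corona G H) (Inr (u, x)) ((\<lambda>v. Inr (v, a)) ` pverts G) = adj_dist H x a"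
proof -
  interpret G: pair_graph G by (rule G)
  have "adj_dist H x a \<le> dC (Inr (u, x)) (Inr (v, a))" if v: "v \<in> pverts G" for v
    using dC_Inr_Inr[OF u x v a] adj_dist_bounds(2)[of H x a] graph_dist_nonneg[OF G, of u v]
    by (auto intro: order_trans add_increasing)
  moreover have "dC (Inr (u, x)) (Inr (u, a)) = adj_dist H x a"
    using dC_Inr_Inr[OF u x u a] by simp
  ultimately show ?thesis
    unfolding set_dist_def using u G.pair_finite_verts
    by (intro Min_eqI) (auto simp: image_image intro: rev_image_eqI)
qed

section \<open>The partition of the corona\<close>

text \<open>Known as an adjacency resolving set, or adjacency generator, of
  \<open>H\<close>.\<close>

definition separates :: "'b set \<Rightarrow> bool" where
  "separates A \<longleftrightarrow> A \<subseteq> pverts H \<and>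
     (\<forall>x\<in>pverts H. \<forall>y\<in>pverts H. x \<noteq> y \<longrightarrow> (\<exists>a\<in>A. adj_dist H x a \<noteq> adj_dist H y a))"

text \<open>Two vertices of one copy are equidistant from every vertex outside that copy, so a
  landmark telling them apart lies inside it, where distances are given by
  \<open>adj_dist\<close>.\<close>

lemma resolving_set_separates:
  assumes S: "resolving_set (corona G H) S" and v: "v \<in> pverts G"
  shows "separates {x \<in> pverts H. Inr (v, x) \<in> set S}"
  unfolding separates_def
proof (intro conjI ballI impI)
  fix x y assume x: "x \<in> pverts H" and y: "y \<in> pverts H" and xy: "x \<noteq> y"
  then have "metric_rep (corona G H) S (Inr (v, x)) \<noteq> metric_rep (corona G H) S (Inr (v, y))"
    using S v unfolding resolving_set_def by (auto simp: corona_def)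
  then obtain s where s: "s \<in> set S" "dC (Inr (v, x)) s \<noteq> dC (Inr (v, y)) s"
    by (auto simp: metric_rep_def)
  have "s \<in> pverts (corona G H)" using S s by (auto simp: resolving_set_def)
  then consider w where "s = Inl w" "w \<in> pverts G"
    | w a where "s = Inr (w, a)" "w \<in> pverts G" "a \<in> pverts H"
    by (auto simp: corona_def)
  then show "\<exists>a\<in>{x \<in> pverts H. Inr (v, x) \<in> set S}. adj_dist H x a \<noteq> adj_dist H y a"
  proof cases
    case 1
    then show ?thesis using s(2) dC_Inl(2)[of w v] v x y by simp
  next
    case 2
    then have "w = v" "adj_dist H x a \<noteq> adj_dist H y a"
      using s(2) dC_Inr_Inr[OF v _ 2(2,3)] x y by (auto split: if_splits)
    then show ?thesis using 2 s(1) by blast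
  qed
qed auto

text \<open>One class \<open>K a\<close> serves all copies of \<open>H\<close> simultaneously, so
  the classes made from \<open>A\<close> number at most \<open>card A\<close>, independently of the
  order of \<open>G\<close>.\<close>

lemma partition_dim_corona_le:
  assumes A: "separates A" and ne: "pverts G \<noteq> {}"
  shows "partition_dim (corona G H) \<le> card A + partition_dim G + 1"
proof -
  interpret H: pair_graph H by (rule H)
  have AH: "A \<subseteq> pverts H" using A by (simp add: separates_def)
  then have finA: "finite A" using H.pair_finite_verts finite_subset by blast
  obtain \<Q> where \<Q>: "finite \<Q>" "partition_on (pverts G) \<Q>" "card \<Q> = partition_dim G"
    and sepQ: "\<And>u v. u \<in> pverts G \<Longrightarrow> v \<in> pverts G \<Longrightarrow> u \<noteq> v \<Longrightarrow>
      \<exists>Q\<in>\<Q>. set_dist G u Q \<noteq> set_dist G v Q"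
    using obtain_min_resolving_partition[OF G] by metis
  have \<Q>_sub: "Q \<subseteq> pverts G" "Q \<noteq> {}" if "Q \<in> \<Q>" for Q
    using that \<Q>(2) by (auto simp: partition_on_def)
  define K where "K a = (\<lambda>v. Inr (v, a) :: 'a + 'a \<times> 'b) ` pverts G" for a
  define R where "R = (Inr ` (pverts G \<times> (pverts H - A)) :: ('a + 'a \<times> 'b) set)"
  define L where "L Q = (Inl ` Q :: ('a + 'a \<times> 'b) set)" for Q :: "'a set"
  \<comment> \<open>\<open>R\<close> is empty when \<open>A\<close> is the whole vertex set of \<open>H\<close>, hence the difference with \<open>{{}}\<close>.\<close>
  define \<P> where "\<P> = K ` A \<union> ({R} - {{}}) \<union> L ` \<Q>"
  have "partition_on (pverts (corona G H)) \<P>"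
  proof (rule partition_onI)
    have "\<Union> (L ` \<Q>) = Inl ` pverts G"
      using partition_onD1[OF \<Q>(2)] by (auto simp: L_def)
    moreover have "\<Union> (K ` A) \<union> R = Inr ` (pverts G \<times> pverts H)"
      using AH by (auto simp: K_def R_def)
    moreover have "\<Union> \<P> = \<Union> (K ` A) \<union> R \<union> \<Union> (L ` \<Q>)"
      unfolding \<P>_def by blast
    ultimately show "\<Union> \<P> = pverts (corona G H)"
      by (simp add: corona_def Un_commute)
  next
    have "disjnt (K a) (K b)" if "a \<noteq> b" for a b using that by (auto simp: K_def disjnt_def)
    moreover have "disjnt (K a) R" "disjnt R (K a)" if "a \<in> A" for a
      using that by (auto simp: K_def R_def disjnt_def)
    moreover have "disjnt (K a) (L Q)" "disjnt (L Q) (K a)" for a Q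
      by (auto simp: K_def L_def disjnt_def)
    moreover have "disjnt R (L Q)" "disjnt (L Q) R" for Q
      by (auto simp: R_def L_def disjnt_def)
    moreover have "disjnt (L P) (L Q)"
      if "P \<in> \<Q>" "Q \<in> \<Q>" "P \<noteq> Q" for P Q
      using partition_onD2[OF \<Q>(2)] that by (auto simp: L_def disjoint_def disjnt_def)
    ultimately show "disjnt p q" if "p \<in> \<P>" "q \<in> \<P>" "p \<noteq> q" for p q
      using that unfolding \<P>_def by (elim UnE imageE DiffE singletonE) metis+
  next
    show "{} \<notin> \<P>" using ne \<Q>_sub by (auto simp: \<P>_def K_def L_def)
  qed
  moreover have "finite \<P>" using finA \<Q>(1) by (simp add: \<P>_def)
  moreover have "\<exists>P\<in>\<P>. set_dist (corona G H) s P \<noteq> set_dist (corona G H) t P"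
    if C: "C \<in> \<P>" "s \<in> C" "t \<in> C" "s \<noteq> t" for C s t
  proof -
    \<comment> \<open>\<open>K a\<close> and \<open>R\<close> consist of copy vertices and
      \<open>L Q\<close> of roots, so a root and a copy vertex never share a class.\<close>
    consider u v where "s = Inl u" "t = Inl v" "u \<in> pverts G" "v \<in> pverts G"
      | u x v y where "s = Inr (u, x)" "t = Inr (v, y)" "u \<in> pverts G" "v \<in> pverts G"
          "x \<in> pverts H" "y \<in> pverts H"
    proof -
      have "(\<exists>a\<in>A. C = K a) \<or> C = R \<or> (\<exists>Q\<in>\<Q>. C = L Q)"
        using C(1) unfolding \<P>_def by blast
      then show thesis
        using that C(2,3) AH \<Q>_sub(1) unfolding K_def R_def L_def by blast
    qed
    then show ?thesis
    proof cases
      case 1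
      then obtain Q where Q: "Q \<in> \<Q>" "set_dist G u Q \<noteq> set_dist G v Q"
        using sepQ[of u v] C by auto
      then have "set_dist (corona G H) s (L Q) \<noteq> set_dist (corona G H) t (L Q)"
        using 1 set_dist_Inl(1)[OF \<Q>_sub[OF Q(1)]] by (simp add: L_def)
      then show ?thesis using Q(1) by (auto simp: \<P>_def)
    next
      case 2
      show ?thesis
      proof (cases "u = v")
        case True
        then obtain a where a: "a \<in> A" "adj_dist H x a \<noteq> adj_dist H y a"
          using 2 C A unfolding separates_def by blast
        then have "set_dist (corona G H) s (K a) \<noteq> set_dist (corona G H) t (K a)"
          using 2 AH set_dist_copies unfolding K_def by auto
        then show ?thesis using a(1) by (auto simp: \<P>_def)
      next
        case False
        then obtain Q where Q: "Q \<in> \<Q>" "set_dist G u Q \<noteq> set_dist G v Q"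
          using sepQ[of u v] 2 by auto
        \<comment> \<open>Adding the finite value 1 is injective on \<open>ereal\<close>, so the
          shift from the roots to their copies keeps the separation.\<close>
        have "set_dist G u Q + 1 \<noteq> set_dist G v Q + 1"
          using Q(2) by (cases "set_dist G u Q"; cases "set_dist G v Q") (auto simp: one_ereal_def)
        then have "set_dist (corona G H) s (L Q) \<noteq> set_dist (corona G H) t (L Q)"
          using 2 set_dist_Inl(2)[OF \<Q>_sub[OF Q(1)]] by (simp add: L_def)
        then show ?thesis using Q(1) by (auto simp: \<P>_def)
      qed
    qed
  qed
  ultimately have "partition_dim (corona G H) \<le> card \<P>"
    by (intro partition_dim_le_card[OF C]) auto
  also have "\<dots> \<le> card (K ` A) + card ({R} - {{}}) + card (L ` \<Q>)"
    unfolding \<P>_def by (meson add_right_mono card_Un_le le_trans)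
  also have "\<dots> \<le> card A + 1 + card \<Q>"
    using card_mono[of "{R}" "{R} - {{}}"] finA \<Q>(1)
    by (intro add_mono card_image_le) auto
  finally show ?thesis using \<Q>(3) by simp
qed

text \<open>The smallest of the sets that a minimum resolving set cuts out in the copies has at most
  average size. The bound is a product to stay within \<open>nat\<close>.\<close>

lemma obtain_small_separating_set:
  assumes ne: "pverts G \<noteq> {}"
  obtains A where "separates A" "card (pverts G) * card A \<le> metric_dim (corona G H)"
proof -
  interpret G: pair_graph G by (rule G)
  interpret H: pair_graph H by (rule H)
  obtain S where S: "resolving_set (corona G H) S" "length S = metric_dim (corona G H)"
    using obtain_min_resolving_set[OF C] .
  define A where "A v = {x \<in> pverts H. Inr (v, x) \<in> set S}" for v
  have "(\<Sum>v\<in>pverts G. card (A v)) = card (SIGMA v:pverts G. A v)"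
    using G.pair_finite_verts H.pair_finite_verts by (simp add: A_def)
  \<comment> \<open>The landmarks inside copies are counted once each. Landmarks among the roots are
    dropped, hence only an inequality with \<open>card (set S)\<close> follows.\<close>
  also have "\<dots> = card (Inr ` (SIGMA v:pverts G. A v) :: ('a + 'a \<times> 'b) set)"
    by (simp add: card_image)
  also have "\<dots> \<le> card (set S)"
    by (rule card_mono) (auto simp: A_def)
  also have "\<dots> \<le> length S" by (rule card_length)
  finally have le: "(\<Sum>v\<in>pverts G. card (A v)) \<le> length S" .
  obtain v where v: "v \<in> pverts G" "\<And>w. w \<in> pverts G \<Longrightarrow> card (A v) \<le> card (A w)"
    using arg_min_if_finite[OF G.pair_finite_verts ne, of "\<lambda>v. card (A v)"] by (meson not_le)
  have "card (pverts G) * card (A v) \<le> (\<Sum>v\<in>pverts G. card (A v))"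
    using sum_bounded_below[of "pverts G" "card (A v)" "\<lambda>v. card (A v)"] v(2) by simp
  then show thesis
    using that[of "A v"] le S resolving_set_separates[OF S(1) v(1)] by (simp add: A_def)
qed

end

theorem theorem2:
  fixes G :: "'a pair_pre_digraph" and H :: "'b pair_pre_digraph" and n1 n2 :: nat
  assumes "pair_graph G" and "connected (with_proj G)"
    and "card (pverts G) = n1" and "n1 \<ge> 2"
    and "pair_graph H" and "card (pverts H) = n2"
  shows "real (partition_dim (corona G H))
    \<le> 1 / real n1 * real (metric_dim (corona G H)) + real (partition_dim G) + 1"
proof -
  interpret corona_graph G H using assms(1,5) by (rule corona_graph.intro)
  have ne: "pverts G \<noteq> {}" using assms(3,4) by auto
  obtain A where A: "separates A" "n1 * card A \<le> metric_dim (corona G H)"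
    using obtain_small_separating_set[OF ne] assms(3) by blast
  have "real n1 * real (card A) \<le> real (metric_dim (corona G H))"
    using A(2) by (metis of_nat_le_iff of_nat_mult)
  then have "real (card A) \<le> 1 / real n1 * real (metric_dim (corona G H))"
    using assms(4) by (simp add: field_simps)
  moreover have "real (partition_dim (corona G H)) \<le> real (card A + partition_dim G + 1)"
    using partition_dim_corona_le[OF A(1) ne] by (simp only: of_nat_le_iff)
  ultimately show ?thesis by simp
qed

end
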